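(* There exists a string family on which $\ell = \Omega(g_{rl}\log n/\log\log n)$. That is, there is an infinite set $\mathcal{F}$ of strings such that $\ell(w)=\Omega\big(g_{rl}(w)\log n/\log\log n\big)$ for $w\in\mathcal{F}$, where $n=|w|$.
   Context: A string family is an infinite set of finite strings of unbounded length; asymptotic notation on a family refers to strings $w$ of the family with $n=|w|\to\infty$ (with constants uniform over the family). $w[i:j]$ denotes the substring of $w$ from position $i$ to position $j$ (positions start at 1). L-systems: an L-system is a tuple $(\Sigma,\varphi,\tau,s,d,n)$, where $\Sigma$ is a finite alphabet, $\varphi:\Sigma^*\to\Sigma^*$ is a non-erasing monoid endomorphism (each rule $a\to\varphi(a)$, $a\in\Sigma$, has $|\varphi(a)|\ge 1$), $\tau:\Sigma^*\to\Sigma^*$ is a coding (a morphism with $|\tau(a)|=1$ for all $a\in\Sigma$), $s\in\Sigma^+$ is the axiom, and $d\ge 0$, $n\ge 1$ are integers. It generates the unique string $\tau(\varphi^d(s))[1:n]$ of length $n$. It is always assumed that $d=n^{O(1)}$ and $|\Sigma|=n^{O(1)}$ (each value fits in an $O(\log n)$-bit word). The size of the L-system is $\sum_{a\in\Sigma}|\varphi(a)|+|s|+|\Sigma|+2$. The measure $\ell(w)$ is the size of the smallest L-system generating $w$. Run-length grammars: a straight-line program (SLP) is a deterministic context-free grammar whose language is a single string $\{w\}$; its size is the sum of the lengths of the right-hand sides of its rules. A run-length SLP (RLSLP) additionally allows rules of the form $A\to a^m$ with $m>1$ ($a$ a grammar symbol), each counted as having constant size. $g_{rl}(w)$ is the size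 of the smallest RLSLP generating $w$. *)

theory Defs
  imports Complex_Main "HOL-Library.Landau_Symbols"
begin

text \<open>Symbols are natural numbers: a fixed infinite supply, so that neither an L-system nor a
  grammar ever runs out of fresh variables.\<close>

type_synonym word = "nat list"

definition string_family :: "word set \<Rightarrow> bool" where
  "string_family F \<longleftrightarrow> infinite F \<and> (\<forall>N. \<exists>w\<in>F. N \<le> length w)"

definition growing :: "word set \<Rightarrow> word filter" where
  "growing F = inf (filtercomap length at_top) (principal F)"

lemma eventually_growing:
  "eventually P (growing F) \<longleftrightarrow> (\<exists>N. \<forall>w\<in>F. N \<le> length w \<longrightarrow> P w)"
  unfolding growing_def eventually_inf_principal eventually_filtercomap_at_top_linorder
  by auto

subsection \<open>L-systems\<close>

text \<open>The endomorphism and the coding are given by their values on single letters; values outside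
  the alphabet play no role.\<close>

record lsystem =
  ls_alphabet :: "nat set"
  ls_rule :: "nat \<Rightarrow> word"
  ls_coding :: "nat \<Rightarrow> nat"
  ls_axiom :: word
  ls_depth :: nat
  ls_length :: nat

definition lsystem_wf :: "lsystem \<Rightarrow> bool" where
  "lsystem_wf L \<longleftrightarrow>
     finite (ls_alphabet L) \<and>
     (\<forall>a\<in>ls_alphabet L. ls_rule L a \<in> lists (ls_alphabet L) \<and> length (ls_rule L a) \<ge> 1) \<and>
     (\<forall>a\<in>ls_alphabet L. ls_coding L a \<in> ls_alphabet L) \<and>
     ls_axiom L \<in> lists (ls_alphabet L) \<and> ls_axiom L \<noteq> [] \<and>
     ls_length L \<ge> 1"

definition morphism :: "(nat \<Rightarrow> word) \<Rightarrow> word \<Rightarrow> word" where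
  "morphism \<phi> u = concat (map \<phi> u)"

definition lsystem_word :: "lsystem \<Rightarrow> word" where
  "lsystem_word L = map (ls_coding L) ((morphism (ls_rule L) ^^ ls_depth L) (ls_axiom L))"

definition lsystem_generates :: "lsystem \<Rightarrow> word \<Rightarrow> bool" where
  "lsystem_generates L w \<longleftrightarrow>
     lsystem_wf L \<and> ls_length L \<le> length (lsystem_word L) \<and>
     w = take (ls_length L) (lsystem_word L)"

definition lsystem_size :: "lsystem \<Rightarrow> nat" where
  "lsystem_size L =
     (\<Sum>a\<in>ls_alphabet L. length (ls_rule L a)) + length (ls_axiom L) + card (ls_alphabet L) + 2"

text \<open>The standing assumption that the depth and the alphabet size are polynomial in the length
  \<open>n\<close> of the generated string, with the exponent \<open>k\<close> made explicit.\<close>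

definition lsystem_poly :: "nat \<Rightarrow> lsystem \<Rightarrow> bool" where
  "lsystem_poly k L \<longleftrightarrow>
     ls_depth L \<le> ls_length L ^ k \<and> card (ls_alphabet L) \<le> ls_length L ^ k"

definition ell :: "nat \<Rightarrow> word \<Rightarrow> nat" where
  "ell k w = Inf (lsystem_size ` {L. lsystem_generates L w \<and> lsystem_poly k L})"

text \<open>On natural numbers \<open>Inf {} = 0\<close>; for \<open>k \<ge> 1\<close> and nonempty words this does not occur.\<close>

lemma lsystem_exists:
  assumes "w \<noteq> []" "k \<ge> 1"
  shows "\<exists>L. lsystem_generates L w \<and> lsystem_poly k L"
proof -
  define L where "L = \<lparr>ls_alphabet = set w, ls_rule = (\<lambda>a. [a]), ls_coding = id,
    ls_axiom = w, ls_depth = 0, ls_length = length w\<rparr>"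
  have "lsystem_generates L w"
    using assms
    by (auto simp: L_def lsystem_generates_def lsystem_wf_def lsystem_word_def Suc_le_eq)
  moreover have "card (set w) \<le> length w ^ k"
  proof -
    have "card (set w) \<le> length w ^ 1"
      by (simp add: card_length)
    also have "\<dots> \<le> length w ^ k"
      using assms by (intro power_increasing) (auto simp: Suc_le_eq)
    finally show ?thesis .
  qed
  ultimately show ?thesis
    by (auto simp: L_def lsystem_poly_def)
qed

subsection \<open>Run-length straight-line programs\<close>

datatype gsym = Terminal nat | Nonterminal nat

datatype rhs = Seq "gsym list" | Power gsym nat

fun rhs_word :: "rhs \<Rightarrow> gsym list" where
  "rhs_word (Seq u) = u"
| "rhs_word (Power a m) = replicate m a"

text \<open>A run-length rule is charged 2: the symbol and the exponent.\<close>

fun rhs_size :: "rhs \<Rightarrow> nat" where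
  "rhs_size (Seq u) = length u"
| "rhs_size (Power a m) = 2"

text \<open>Determinism is built in: the rules form a partial function whose domain is the set of
  nonterminals.\<close>

record rlgrammar =
  gr_rules :: "nat \<rightharpoonup> rhs"
  gr_start :: nat

definition rlgrammar_wf :: "rlgrammar \<Rightarrow> bool" where
  "rlgrammar_wf G \<longleftrightarrow>
     finite (dom (gr_rules G)) \<and> gr_start G \<in> dom (gr_rules G) \<and>
     (\<forall>r\<in>ran (gr_rules G). \<forall>B. Nonterminal B \<in> set (rhs_word r) \<longrightarrow> B \<in> dom (gr_rules G)) \<and>
     (\<forall>a m. Power a m \<in> ran (gr_rules G) \<longrightarrow> m > 1)"

inductive derives_step :: "rlgrammar \<Rightarrow> gsym list \<Rightarrow> gsym list \<Rightarrow> bool" for G where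
  "gr_rules G A = Some r \<Longrightarrow> derives_step G (u @ [Nonterminal A] @ v) (u @ rhs_word r @ v)"

definition language :: "rlgrammar \<Rightarrow> word set" where
  "language G = {x. (derives_step G)\<^sup>*\<^sup>* [Nonterminal (gr_start G)] (map Terminal x)}"

definition rlslp_generates :: "rlgrammar \<Rightarrow> word \<Rightarrow> bool" where
  "rlslp_generates G w \<longleftrightarrow> rlgrammar_wf G \<and> language G = {w}"

definition rlgrammar_size :: "rlgrammar \<Rightarrow> nat" where
  "rlgrammar_size G = (\<Sum>A\<in>dom (gr_rules G). rhs_size (the (gr_rules G A)))"

definition g_rl :: "word \<Rightarrow> nat" where
  "g_rl w = Inf (rlgrammar_size ` {G. rlslp_generates G w})"

lemma rlslp_exists: "\<exists>G. rlslp_generates G w"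
proof -
  define G where "G = \<lparr>gr_rules = [0 \<mapsto> Seq (map Terminal w)], gr_start = 0\<rparr>"
  have step: "derives_step G [Nonterminal 0] (map Terminal w)"
    using derives_step.intros[of G 0 "Seq (map Terminal w)" "[]" "[]"] by (simp add: G_def)
  have one: "y = map Terminal w" if "derives_step G [Nonterminal 0] y" for y
    using that by cases (auto simp: G_def append_eq_Cons_conv Cons_eq_append_conv split: if_splits)
  have stop: "\<not> derives_step G (map Terminal x) y" for x y
  proof
    assume "derives_step G (map Terminal x) y"
    then obtain A u v where "map Terminal x = u @ [Nonterminal A] @ v"
      by cases blast
    then have "Nonterminal A \<in> set (map Terminal x)"
      by (metis in_set_conv_decomp append_Cons append_Nil)
    then show False by auto
  qed
  have "x = w" if "x \<in> language G" for x
  proof -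
    have "(derives_step G)\<^sup>*\<^sup>* [Nonterminal 0] (map Terminal x)"
      using that by (simp add: language_def G_def)
    then obtain y where "derives_step G [Nonterminal 0] y"
        and "(derives_step G)\<^sup>*\<^sup>* y (map Terminal x)"
      by (cases rule: converse_rtranclpE) auto
    then have "(derives_step G)\<^sup>*\<^sup>* (map Terminal w) (map Terminal x)"
      using one by blast
    then have "map Terminal w = map Terminal x"
      by (cases rule: converse_rtranclpE) (use stop in auto)
    then show ?thesis
      using inj_map_eq_map[of Terminal] by (auto simp: inj_def)
  qed
  moreover have "w \<in> language G"
    using step by (auto simp: language_def G_def)
  moreover have "rlgrammar_wf G"
    by (auto simp: rlgrammar_wf_def G_def)
  ultimately show ?thesis
    unfolding rlslp_generates_def by blast
qed

end

theory Submission imports Defs begin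

text \<open>
  The proof is a counting argument. An L-system of size \<open>s\<close> is described by \<open>O(s log s)\<close> bits
  together with its depth and its length, that is, \<open>O(k log n)\<close> further bits. A word
  \<open>0^e_1 1 \<dots> 0^e_q 1\<close> has a run-length grammar of size \<open>O(q)\<close>, yet its exponents carry about
  \<open>q log n\<close> bits. Hence, as soon as \<open>q\<close> exceeds a fixed multiple of \<open>k\<close>, some such word needs
  \<open>s log s = \<Omega>(q log n)\<close>, that is, \<open>s = \<Omega>(q log n / log log n)\<close>. Letting \<open>k\<close> grow along the
  family makes a single family work for every \<open>k\<close>, because \<open>ell k\<close> decreases in \<open>k\<close>.
\<close>

subsection \<open>Counting words generated by small L-systems\<close>

lemma card_lists_length_le_power:
  assumes "finite A"
  shows "card {xs. set xs \<subseteq> A \<and> length xs \<le> n} \<le> (card A + 1) ^ n"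
proof -
  have "(\<Sum>i\<le>n. card A ^ i) \<le> (card A + 1) ^ n"
  proof (induction n)
    case (Suc n)
    have "card A ^ Suc n \<le> card A * (card A + 1) ^ n"
      by (simp add: power_mono)
    from add_mono[OF Suc this] show ?case by simp
  qed simp
  then show ?thesis
    using assms by (simp add: card_lists_length_le)
qed

text \<open>Blocks may be empty, so their number needs a bound of its own; the bound on the
  concatenation alone would leave infinitely many lists.\<close>

definition factorizations :: "'a set \<Rightarrow> nat \<Rightarrow> 'a list list set" where
  "factorizations A n =
     {xss. set (concat xss) \<subseteq> A \<and> length (concat xss) \<le> n \<and> length xss \<le> n}"

text \<open>A list of words is recovered from its concatenation and its list of block lengths. Both
  are lists of length at most \<open>n\<close>, the first over \<open>A\<close> and the second over
  the \<open>n + 1\<close> numbers up to \<open>n\<close>; each contributes one factor. In bits,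
  this is the \<open>s log s\<close> cost of writing down all rules.\<close>

lemma factorizations_bound:
  assumes "finite A"
  shows "finite (factorizations A n)"
    and "card (factorizations A n) \<le> (card A + 1) ^ n * (n + 2) ^ n"
proof -
  let ?f = "\<lambda>xss::'a list list. (concat xss, map length xss)"
  let ?U = "{xs. set xs \<subseteq> A \<and> length xs \<le> n}"
  let ?V = "{xs. set xs \<subseteq> {..n} \<and> length xs \<le> n}"
  have inj: "inj_on ?f (factorizations A n)"
  proof (rule inj_onI)
    fix xss yss :: "'a list list"
    assume "?f xss = ?f yss"
    then have *: "concat xss = concat yss" "map length xss = map length yss"
      by auto
    show "xss = yss"
    proof (rule concat_injective)
      show "length xss = length yss"
        using *(2) by (metis length_map)
      then show "\<forall>(x, y)\<in>set (zip xss yss). length x = length y"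
        using *(2) by (auto simp: set_zip) (metis nth_map)
    qed (use * in simp)
  qed
  have sub: "?f ` factorizations A n \<subseteq> ?U \<times> ?V"
  proof -
    have "length x \<le> n" if "length (concat xss) \<le> n" "x \<in> set xss" for xss :: "'a list list" and x
      using that member_le_sum_list[of "length x" "map length xss"] by (simp add: length_concat)
    then show ?thesis
      by (auto simp: factorizations_def)
  qed
  have fin: "finite (?U \<times> ?V)"
    using assms by (intro finite_cartesian_product finite_lists_length_le) auto
  show "finite (factorizations A n)"
    using inj sub fin by (rule inj_on_finite)
  have "card (factorizations A n) \<le> card (?U \<times> ?V)"
    using inj sub fin by (rule card_inj_on_le)
  also have "\<dots> = card ?U * card ?V"
    by (rule card_cartesian_product)
  also have "\<dots> \<le> (card A + 1) ^ n * (n + 2) ^ n"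
    using card_lists_length_le_power[OF assms, of n] card_lists_length_le_power[of "{..n}" n]
    by (intro mult_mono) auto
  finally show "card (factorizations A n) \<le> (card A + 1) ^ n * (n + 2) ^ n" .
qed

section \<open>Encoding an L-system by finite data\<close>

text \<open>The axiom is stored in front of the right-hand sides of the rules.\<close>

fun decode :: "nat \<Rightarrow> word list \<times> word \<times> nat \<Rightarrow> word" where
  "decode n (xss, cs, d) =
     take n (map ((!) cs) ((morphism ((!) (tl xss)) ^^ d) (hd xss)))"

lemma morphism_in_lists:
  assumes "\<forall>a\<in>A. \<phi> a \<in> lists A" "u \<in> lists A"
  shows "(morphism \<phi> ^^ d) u \<in> lists A"
  using assms by (induction d) (fastforce simp: morphism_def)+

text \<open>\<open>h\<close> intertwines the two morphisms on words over \<open>A\<close>, and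
  iterates of \<open>\<phi>\<close> never leave \<open>A\<close>. This permits replacing an
  arbitrary alphabet by an initial segment of the naturals, so that rules become list
  entries.\<close>

lemma morphism_rename:
  assumes "\<forall>a\<in>A. \<phi> a \<in> lists A" "\<forall>a\<in>A. \<psi> (h a) = map h (\<phi> a)" "u \<in> lists A"
  shows "(morphism \<psi> ^^ d) (map h u) = map h ((morphism \<phi> ^^ d) u)"
proof (induction d)
  case (Suc d)
  have "morphism \<psi> (map h v) = map h (morphism \<phi> v)" if "v \<in> lists A" for v
    using that assms(2) by (induction v) (auto simp: morphism_def)
  with Suc morphism_in_lists[OF assms(1,3)] show ?case by simp
qed simp

text \<open>Letters are renamed to 0, ..., \<open>m - 1\<close> with \<open>m = card A\<close>,
  which is below \<open>s\<close>. Axiom and rules then form one factorization over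
  \<open>{..<s}\<close>, and the coding becomes a table. Only the depth stays unbounded in terms of
  \<open>s\<close>.\<close>

lemma lsystem_decode:
  assumes gen: "lsystem_generates L w" and size: "lsystem_size L \<le> s" and bin: "set w \<subseteq> {0, 1}"
  obtains xss cs where
    "xss \<in> factorizations {..<s} s" "set cs \<subseteq> {0, 1}" "length cs \<le> s"
    "w = decode (length w) (xss, cs, ls_depth L)"
proof -
  define A where "A = ls_alphabet L"
  define \<phi> where "\<phi> = ls_rule L"
  define m where "m = card A"
  have wf: "finite A" "\<forall>a\<in>A. \<phi> a \<in> lists A" "ls_axiom L \<in> lists A"
    using gen by (auto simp: lsystem_generates_def lsystem_wf_def A_def \<phi>_def)
  obtain h where h: "bij_betw h A {0..<m}"
    using ex_bij_betw_finite_nat[OF wf(1)] unfolding m_def by blast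
  define g where "g = inv_into A h"
  have hA: "h a < m" if "a \<in> A" for a
    using h that by (auto simp: bij_betw_def)
  have gh: "g (h a) = a" if "a \<in> A" for a
    using h that by (auto simp: bij_betw_def g_def)
  have gA: "g i \<in> A" if "i < m" for i
    using h that by (auto simp: bij_betw_def g_def intro!: inv_into_into)
  have g_bij: "bij_betw g {0..<m} A"
    unfolding g_def using h by (rule bij_betw_inv_into)
  \<comment> \<open>The coding may take other values on letters that do not show in the prefix
    \<open>w\<close>. Collapsing these to 0 makes the table binary and leaves \<open>w\<close>
    unchanged.\<close>
  define bit :: "nat \<Rightarrow> nat" where "bit c = (if c = 1 then 1 else 0)" for c
  define rules where "rules = map (\<lambda>i. map h (\<phi> (g i))) [0..<m]"
  define xss where "xss = map h (ls_axiom L) # rules"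
  define cs where "cs = map (\<lambda>i. bit (ls_coding L (g i))) [0..<m]"
  have sz: "(\<Sum>a\<in>A. length (\<phi> a)) + length (ls_axiom L) + m + 2 \<le> s"
    using size by (simp add: lsystem_size_def A_def \<phi>_def m_def)
  have "length (concat rules) = (\<Sum>i\<in>{0..<m}. length (\<phi> (g i)))"
    by (simp add: rules_def length_concat o_def interv_sum_list_conv_sum_set_nat)
  also have "\<dots> = (\<Sum>a\<in>A. length (\<phi> a))"
    by (rule sum.reindex_bij_betw[OF g_bij])
  finally have "length (concat xss) \<le> s"
    using sz by (simp add: xss_def)
  \<comment> \<open>There are \<open>m + 1\<close> blocks: the axiom and one per rule. The constant
    2 in the size pays for the extra one.\<close>
  moreover have "length xss \<le> s"
    using sz by (simp add: xss_def rules_def)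
  moreover have "set (concat xss) \<subseteq> {..<s}"
  proof -
    have "set (concat xss) \<subseteq> h ` A"
      using wf gA by (fastforce simp: xss_def rules_def)
    also have "\<dots> \<subseteq> {..<s}"
      using hA sz by fastforce
    finally show ?thesis .
  qed
  ultimately have "xss \<in> factorizations {..<s} s"
    by (simp add: factorizations_def)
  moreover have "set cs \<subseteq> {0, 1}" "length cs \<le> s"
    using sz by (auto simp: cs_def bit_def)
  moreover have "w = decode (length w) (xss, cs, ls_depth L)"
  proof -
    define v where "v = (morphism \<phi> ^^ ls_depth L) (ls_axiom L)"
    have v: "v \<in> lists A"
      unfolding v_def using wf by (intro morphism_in_lists)
    have "(morphism ((!) rules) ^^ ls_depth L) (map h (ls_axiom L)) = map h v"
      unfolding v_def using wf(2,3) hA gh by (intro morphism_rename) (auto simp: rules_def)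
    then have "decode (length w) (xss, cs, ls_depth L) = take (length w) (map (\<lambda>a. cs ! h a) v)"
      by (simp add: xss_def o_def)
    also have "map (\<lambda>a. cs ! h a) v = map bit (map (ls_coding L) v)"
      using v hA gh by (auto simp: cs_def)
    also have "take (length w) \<dots> = map bit (take (length w) (map (ls_coding L) v))"
      by (simp add: take_map)
    also have "take (length w) (map (ls_coding L) v) = w"
      using gen by (auto simp: lsystem_generates_def lsystem_word_def v_def \<phi>_def min_def)
    also have "map bit w = w"
      using bin by (intro map_idI) (auto simp: bit_def)
    finally show ?thesis ..
  qed
  ultimately show thesis by (rule that)
qed

section \<open>Few binary words of a given length have small L-systems\<close>

definition small_words :: "nat \<Rightarrow> nat \<Rightarrow> nat \<Rightarrow> word set" where
  "small_words k n s = {w. set w \<subseteq> {0, 1} \<and> length w = n \<and>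
     (\<exists>L. lsystem_generates L w \<and> lsystem_poly k L \<and> lsystem_size L \<le> s)}"

text \<open>Every such word is decoded from a factorization, a binary coding table and a depth. The
  factorization costs two factors \<open>(s + 2) ^ s\<close>, the table one, and the depth has
  \<open>n ^ k + 1\<close> values.\<close>

lemma small_words_bound:
  "finite (small_words k n s)"
  "card (small_words k n s) \<le> (s + 2) ^ (3 * s) * (n ^ k + 1)"
proof -
  let ?T = "{cs::word. set cs \<subseteq> {0, 1} \<and> length cs \<le> s}"
  let ?C = "factorizations {..<s} s \<times> ?T \<times> {..n ^ k}"
  have fin: "finite ?C"
    by (intro finite_cartesian_product finite_lists_length_le factorizations_bound) auto
  have sub: "small_words k n s \<subseteq> decode n ` ?C"
  proof
    fix w assume "w \<in> small_words k n s"
    then obtain L where w: "set w \<subseteq> {0, 1}" "length w = n" and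
      L: "lsystem_generates L w" "lsystem_poly k L" "lsystem_size L \<le> s"
      by (auto simp: small_words_def)
    obtain xss cs where c: "xss \<in> factorizations {..<s} s" "set cs \<subseteq> {0, 1}" "length cs \<le> s"
      "w = decode (length w) (xss, cs, ls_depth L)"
      using lsystem_decode[OF L(1,3) w(1)] .
    have "ls_length L = n"
      using L(1) w(2) by (auto simp: lsystem_generates_def)
    then have "(xss, cs, ls_depth L) \<in> ?C"
      using c L(2) by (auto simp: lsystem_poly_def)
    then show "w \<in> decode n ` ?C"
      using c(4) w(2) by blast
  qed
  show "finite (small_words k n s)"
    using sub fin by (meson finite_imageI finite_subset)
  have T: "card ?T \<le> (s + 2) ^ s"
  proof -
    have "card ?T \<le> 3 ^ s"
      using card_lists_length_le_power[of "{0::nat, 1}" s] by (simp add: eval_nat_numeral)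
    \<comment> \<open>For \<open>s = 0\<close> the base 3 exceeds \<open>s + 2\<close>, but both
      powers are 1.\<close>
    also have "\<dots> \<le> (s + 2) ^ s"
      by (cases "s = 0") (auto intro: power_mono)
    finally show ?thesis .
  qed
  have "card (factorizations {..<s} s) \<le> (s + 1) ^ s * (s + 2) ^ s"
    using factorizations_bound(2)[of "{..<s}" s] by simp
  also have "\<dots> \<le> (s + 2) ^ s * (s + 2) ^ s"
    by (intro mult_mono power_mono) auto
  finally have S: "card (factorizations {..<s} s) \<le> (s + 2) ^ s * (s + 2) ^ s" .
  have "card (small_words k n s) \<le> card ?C"
    using sub fin by (rule surj_card_le[rotated])
  also have "\<dots> = card (factorizations {..<s} s) * (card ?T * (n ^ k + 1))"
    by (simp only: card_cartesian_product card_atMost Suc_eq_plus1)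
  also have "\<dots> \<le> ((s + 2) ^ s * (s + 2) ^ s) * ((s + 2) ^ s * (n ^ k + 1))"
    using S T by (intro mult_mono) auto
  also have "\<dots> = (s + 2) ^ (3 * s) * (n ^ k + 1)"
  proof -
    have "3 * s = s + s + s"
      by simp
    then show ?thesis
      by (simp only: power_add mult.assoc)
  qed
  finally show "card (small_words k n s) \<le> (s + 2) ^ (3 * s) * (n ^ k + 1)" .
qed

section \<open>From the count to lower bounds on \<open>ell\<close>\<close>

text \<open>Existence of an L-system excludes the default \<open>Inf {} = 0\<close>, which would
  break every lower bound.\<close>

lemma ell_attained:
  assumes "w \<noteq> []" "k \<ge> 1"
  obtains L where "lsystem_generates L w" "lsystem_poly k L" "lsystem_size L = ell k w"
proof -
  have "ell k w \<in> lsystem_size ` {L. lsystem_generates L w \<and> lsystem_poly k L}"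
    unfolding ell_def using lsystem_exists[OF assms] by (intro Inf_nat_def1) blast
  then show thesis
    using that by auto
qed

lemma lsystem_poly_mono:
  assumes "lsystem_generates L w" "lsystem_poly k L" "k \<le> l"
  shows "lsystem_poly l L"
proof -
  have "ls_length L ^ k \<le> ls_length L ^ l"
    using assms by (intro power_increasing) (auto simp: lsystem_generates_def lsystem_wf_def)
  with assms(2) show ?thesis
    by (auto simp: lsystem_poly_def)
qed

text \<open>An optimal L-system for \<open>k\<close> also satisfies the polynomial bounds for any
  \<open>l >= k\<close>. Hence a word that is hard for \<open>l\<close> is hard for all smaller
  exponents.\<close>

lemma ell_gt:
  assumes "w \<notin> small_words l (length w) s" "set w \<subseteq> {0, 1}" "w \<noteq> []" "1 \<le> k" "k \<le> l"
  shows "s < ell k w"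
proof (rule ccontr)
  assume "\<not> s < ell k w"
  moreover obtain L where "lsystem_generates L w" "lsystem_poly k L" "lsystem_size L = ell k w"
    using ell_attained[OF assms(3,4)] .
  ultimately show False
    using assms lsystem_poly_mono[of L w k l] by (auto simp: small_words_def)
qed

subsection \<open>Words with few runs\<close>

text \<open>The 1 closing each run serves as a delimiter, which makes the list of exponents
  recoverable from the word.\<close>

definition runs :: "nat list \<Rightarrow> word" where
  "runs es = concat (map (\<lambda>e. replicate e 0 @ [1]) es)"

lemma runs_simps [simp]:
  "runs [] = []" "runs (e # es) = replicate e 0 @ 1 # runs es"
  by (simp_all add: runs_def)

lemma length_runs: "length (runs es) = sum_list es + length es"
  by (induction es) auto

lemma set_runs: "set (runs es) \<subseteq> {0, 1}"
  by (auto simp: runs_def)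

lemma replicate_append_Cons_inject:
  assumes "replicate m a @ b # xs = replicate n a @ b # ys" "a \<noteq> b"
  shows "m = n \<and> xs = ys"
  using assms
proof (induction m arbitrary: n)
  case 0
  then show ?case by (cases n) auto
next
  case (Suc m)
  then show ?case by (cases n) auto
qed

lemma runs_inject: "runs es = runs fs \<Longrightarrow> es = fs"
proof (induction es arbitrary: fs)
  case Nil
  then show ?case by (cases fs) auto
next
  case (Cons e es)
  then obtain f fs' where fs: "fs = f # fs'"
    by (cases fs) auto
  with Cons replicate_append_Cons_inject[of e 0 1 "runs es" f "runs fs'"] show ?case
    by auto
qed

subsection \<open>Grammars\<close>

text \<open>If \<open>val\<close> solves the equations given by the rules, each derivation step
  preserves the value of the sentential form. Uniqueness of the generated word follows without any
  analysis of derivation orders.\<close>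

lemma derives_word_invariant:
  assumes val: "\<And>A r. gr_rules G A = Some r \<Longrightarrow> val (Nonterminal A) = concat (map val (rhs_word r))"
    and "(derives_step G)\<^sup>*\<^sup>* x y"
  shows "concat (map val x) = concat (map val y)"
  using assms(2)
proof induction
  case (step y z)
  from step.hyps(2) val have "concat (map val y) = concat (map val z)"
    by cases simp
  with step.IH show ?case by simp
qed simp

lemma derives_context:
  assumes "(derives_step G)\<^sup>*\<^sup>* x y"
  shows "(derives_step G)\<^sup>*\<^sup>* (u @ x @ v) (u @ y @ v)"
  using assms
proof induction
  case (step y z)
  from step.hyps(2) have "derives_step G (u @ y @ v) (u @ z @ v)"
  proof cases
    case (1 A r u' v')
    with derives_step.intros[of G A r "u @ u'" "v' @ v"] show ?thesis by simp
  qed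
  with step.IH show ?case by simp
qed simp

lemma derives_append:
  assumes "(derives_step G)\<^sup>*\<^sup>* x y" "(derives_step G)\<^sup>*\<^sup>* x' y'"
  shows "(derives_step G)\<^sup>*\<^sup>* (x @ x') (y @ y')"
  using derives_context[OF assms(1), of "[]" x'] derives_context[OF assms(2), of y "[]"] by simp

text \<open>A power can only be an entire right-hand side, so each run gets its own nonterminal
  \<open>Suc i\<close>; the start rule lists them with their delimiters.\<close>

definition runs_grammar :: "nat list \<Rightarrow> rlgrammar" where
  "runs_grammar es = \<lparr>gr_rules = (\<lambda>A. case A of
       0 \<Rightarrow> Some (Seq (concat (map (\<lambda>i. [Nonterminal (Suc i), Terminal 1]) [0..<length es])))
     | Suc i \<Rightarrow> if i < length es then Some (Power (Terminal 0) (es ! i)) else None),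
     gr_start = 0\<rparr>"

lemma gr_start_runs_grammar [simp]: "gr_start (runs_grammar es) = 0"
  by (simp add: runs_grammar_def)

lemma dom_runs_grammar: "dom (gr_rules (runs_grammar es)) = {..length es}"
  by (auto simp: runs_grammar_def split: nat.splits if_splits)

lemma runs_nth: "runs es = concat (map (\<lambda>i. replicate (es ! i) 0 @ [1]) [0..<length es])"
proof -
  have "runs es = runs (map ((!) es) [0..<length es])"
    by (simp add: map_nth)
  then show ?thesis
    by (simp add: runs_def o_def)
qed

lemma language_runs_grammar: "language (runs_grammar es) = {runs es}"
proof -
  let ?G = "runs_grammar es"
  let ?start = "concat (map (\<lambda>i. [Nonterminal (Suc i), Terminal 1]) [0..<length es])"
  have "x = runs es" if "x \<in> language ?G" for x
  proof -
    \<comment> \<open>\<open>val\<close> is the word each symbol is meant to derive.\<close>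
    define val where "val a = (case a of Terminal c \<Rightarrow> [c] | Nonterminal A \<Rightarrow>
      (case A of 0 \<Rightarrow> runs es | Suc i \<Rightarrow> replicate (es ! i) 0))" for a
    have "val (Nonterminal A) = concat (map val (rhs_word r))" if "gr_rules ?G A = Some r" for A r
    proof (cases A)
      case 0
      have "concat (map val (concat (map (\<lambda>i. [Nonterminal (Suc i), Terminal 1]) is))) =
          concat (map (\<lambda>i. replicate (es ! i) 0 @ [1]) is)" for "is"
        by (induction "is") (auto simp: val_def)
      then have "concat (map val ?start) = runs es"
        by (simp add: runs_nth)
      with 0 that show ?thesis
        by (auto simp: runs_grammar_def val_def)
    next
      case (Suc i)
      have "concat (replicate n [c]) = replicate n c" for n and c :: nat
        by (induction n) auto
      with Suc that show ?thesis
        by (auto simp: runs_grammar_def val_def split: if_splits)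
    qed
    moreover have "(derives_step ?G)\<^sup>*\<^sup>* [Nonterminal 0] (map Terminal x)"
      using that by (simp add: language_def)
    ultimately have "concat (map val [Nonterminal 0]) = concat (map val (map Terminal x))"
      by (rule derives_word_invariant)
    then show ?thesis
      by (simp add: val_def o_def)
  qed
  moreover have "runs es \<in> language ?G"
  proof -
    have run: "(derives_step ?G)\<^sup>*\<^sup>* [Nonterminal (Suc i), Terminal 1]
        (map Terminal (replicate (es ! i) 0 @ [1]))" if "i < length es" for i
    proof -
      have "gr_rules ?G (Suc i) = Some (Power (Terminal 0) (es ! i))"
        using that by (simp add: runs_grammar_def)
      from derives_step.intros[OF this, of "[]" "[Terminal 1]"] show ?thesis
        by (simp add: r_into_rtranclp)
    qed
    have "(derives_step ?G)\<^sup>*\<^sup>* (concat (map (\<lambda>i. [Nonterminal (Suc i), Terminal 1]) is))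
        (map Terminal (concat (map (\<lambda>i. replicate (es ! i) 0 @ [1]) is)))"
      if "set is \<subseteq> {..<length es}" for "is"
      using that
    proof (induction "is")
      case (Cons i "is")
      with derives_append[OF run[of i] Cons.IH] show ?case by simp
    qed simp
    from this[of "[0..<length es]"]
    have "(derives_step ?G)\<^sup>*\<^sup>* ?start (map Terminal (runs es))"
      by (simp add: runs_nth atLeast0LessThan)
    moreover have "gr_rules ?G 0 = Some (Seq ?start)"
      by (simp add: runs_grammar_def)
    then have "derives_step ?G [Nonterminal 0] ?start"
      using derives_step.intros[of ?G 0 "Seq ?start" "[]" "[]"] by simp
    ultimately show ?thesis
      by (auto simp: language_def)
  qed
  ultimately show ?thesis by blast
qed

lemma rlgrammar_wf_runs_grammar:
  assumes "\<forall>e\<in>set es. e > 1"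
  shows "rlgrammar_wf (runs_grammar es)"
proof -
  have "B \<le> length es" if "gr_rules (runs_grammar es) A = Some r" "Nonterminal B \<in> set (rhs_word r)"
    for A B r
    using that by (cases A) (auto simp: runs_grammar_def split: if_splits)
  moreover have "n > 1" if "gr_rules (runs_grammar es) A = Some (Power a n)" for A a n
    using that assms by (cases A) (auto simp: runs_grammar_def split: if_splits)
  ultimately show ?thesis
    unfolding rlgrammar_wf_def dom_runs_grammar
    by (auto simp: ran_def)
qed

text \<open>With \<open>q\<close> runs, the start rule has \<open>2 * q\<close> symbols and each of
  the \<open>q\<close> power rules is charged 2.\<close>

lemma rlgrammar_size_runs_grammar: "rlgrammar_size (runs_grammar es) = 4 * length es"
proof -
  have "rlgrammar_size (runs_grammar es) = (\<Sum>A\<le>length es. 2 * (if A = 0 then length es else 1))"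
    unfolding rlgrammar_size_def dom_runs_grammar
    by (intro sum.cong)
       (auto simp: runs_grammar_def length_concat o_def sum_list_triv split: nat.splits)
  also have "\<dots> = 4 * length es"
    by (simp add: sum.atMost_shift)
  finally show ?thesis .
qed

lemma g_rl_runs:
  assumes "\<forall>e\<in>set es. e > 1"
  shows "g_rl (runs es) \<le> 4 * length es"
proof -
  have "rlslp_generates (runs_grammar es) (runs es)"
    using rlgrammar_wf_runs_grammar[OF assms] language_runs_grammar
    by (simp add: rlslp_generates_def)
  then have "g_rl (runs es) \<le> rlgrammar_size (runs_grammar es)"
    unfolding g_rl_def by (intro cInf_lower) auto
  then show ?thesis
    by (simp add: rlgrammar_size_runs_grammar)
qed

subsection \<open>The family\<close>

text \<open>The count of small words is for one fixed length, so a last exponent brings all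
  candidates to length \<open>m\<^sup>2\<close>. There is room for it because the other runs use
  only about a quarter of that length.\<close>

lemma runs_pad:
  assumes "set es \<subseteq> {2..<m + 2}" "length es = p" "4 * p \<le> m" "4 \<le> m"
  defines "fs \<equiv> es @ [m\<^sup>2 - (sum_list es + p + 1)]"
  shows "length (runs fs) = m\<^sup>2" "\<forall>e\<in>set fs. e > 1"
proof -
  have "sum_list es \<le> length es * (m + 1)"
    using assms(1) by (induction es) auto
  \<comment> \<open>The summand 3, rather than 1, leaves at least 2 for the last exponent, as power
    rules require.\<close>
  then have "4 * (sum_list es + p + 3) \<le> 4 * p * (m + 2) + 12"
    using assms(2) by (simp add: algebra_simps)
  also have "\<dots> \<le> m * (m + 2) + 12"
    using assms(3) by (intro add_mono mult_mono) auto
  also have "\<dots> \<le> 4 * m\<^sup>2"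
  proof -
    have "4 * m \<le> m\<^sup>2"
      using assms(4) by (simp add: power2_eq_square)
    then show ?thesis
      using assms(4) unfolding power2_eq_square distrib_left by linarith
  qed
  finally have le: "sum_list es + p + 3 \<le> m\<^sup>2" by simp
  then show "length (runs fs) = m\<^sup>2"
    using assms(2) by (simp add: length_runs fs_def)
  show "\<forall>e\<in>set fs. e > 1"
    using le assms(1) by (auto simp: fs_def)
qed

text \<open>With \<open>n = 2 ^ 2 ^ (p + 1)\<close> the number \<open>p + 1\<close> of runs equals
  \<open>log log n\<close>, and the size threshold \<open>2 ^ (p - 4)\<close> is
  \<open>log n / 32\<close>. The first \<open>p\<close> exponents range freely over
  \<open>m = sqrt n\<close> values each, which gives \<open>m ^ p\<close> words, more than small
  L-systems can produce.\<close>

lemma incompressible_runs: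
  fixes k p :: nat
  assumes p: "p = 4 * (k + 1)"
  obtains es where "length es = p + 1" "\<forall>e\<in>set es. e > 1"
    "length (runs es) = 2 ^ 2 ^ (p + 1)"
    "runs es \<notin> small_words k (2 ^ 2 ^ (p + 1)) (2 ^ (p - 4))"
proof -
  define m :: nat where "m = 2 ^ 2 ^ p"
  define n :: nat where "n = 2 ^ 2 ^ (p + 1)"
  define s :: nat where "s = 2 ^ (p - 4)"
  \<comment> \<open>Starting at 2 gives exactly \<open>m\<close> choices per exponent, all legal in
    power rules.\<close>
  define E where "E = {es::nat list. set es \<subseteq> {2..<m + 2} \<and> length es = p}"
  define pad where "pad es = es @ [n - (sum_list es + p + 1)]" for es
  have n: "n = m\<^sup>2"
    by (simp add: n_def m_def mult.commute flip: power_mult)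
  have p4: "4 \<le> p"
    using p by simp
  have "p + 2 \<le> 2 ^ p"
    using p4 by (induction p rule: dec_induct) auto
  then have "(2::nat) ^ (p + 2) \<le> m"
    unfolding m_def by (intro power_increasing) auto
  moreover have "(2::nat) ^ (p + 2) = 4 * 2 ^ p"
    by (simp add: power_add)
  ultimately have m: "4 * p \<le> m" "4 \<le> m"
    using p4 less_exp[of p] by linarith+
  have pad: "length (runs (pad es)) = n" "\<forall>e\<in>set (pad es). e > 1" if "es \<in> E" for es
    using runs_pad[of es m p] that m by (auto simp: E_def pad_def n)
  have inj: "inj_on (\<lambda>es. runs (pad es)) E"
    by (rule inj_onI) (auto simp: pad_def dest: runs_inject)
  have "card E = m ^ p"
    by (simp add: E_def card_lists_length_eq)
  have s: "16 * s = 2 ^ p"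
  proof -
    have "(2::nat) ^ p = 2 ^ (p - 4) * 2 ^ 4"
      using p4 by (metis le_add_diff_inverse2 power_add)
    then show ?thesis by (simp add: s_def)
  qed
  moreover have "1 \<le> s"
    by (simp add: s_def)
  ultimately have "s + 2 \<le> 2 ^ p"
    by linarith
  then have "(s + 2) ^ (3 * s) \<le> (2 ^ p) ^ (3 * s)"
    by (rule power_mono) simp
  also have "\<dots> = 2 ^ (3 * s * p)"
    by (simp add: mult_ac flip: power_mult)
  \<comment> \<open>Since \<open>16 * s = 2 ^ p\<close>, the exponent \<open>8 * s * p\<close> turns
    the bound into \<open>m ^ (p / 2)\<close>, half of the available power of
    \<open>m\<close>.\<close>
  also have "\<dots> < 2 ^ (8 * s * p)"
    using p4 \<open>1 \<le> s\<close> by (intro power_strict_increasing) auto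
  also have "8 * s * p = 2 ^ p * (2 * (k + 1))"
    unfolding s[symmetric] by (subst p) (simp add: algebra_simps)
  also have "2 ^ \<dots> = m ^ (2 * (k + 1))"
    unfolding m_def by (rule power_mult)
  finally have "(s + 2) ^ (3 * s) < m ^ (2 * (k + 1))" .
  \<comment> \<open>The depths take the other half: \<open>n ^ k + 1 <= n ^ (k + 1)\<close>, and
    \<open>n = m\<^sup>2\<close>.\<close>
  moreover have "n ^ k + 1 \<le> m ^ (2 * (k + 1))"
  proof -
    have "2 \<le> n"
      using m(2) mult_le_mono[of 2 m 1 m] by (simp add: n power2_eq_square)
    then have "1 \<le> n ^ k"
      by (intro one_le_power) linarith
    then have "n ^ k + 1 \<le> 2 * n ^ k"
      by linarith
    also have "\<dots> \<le> n * n ^ k"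
      using \<open>2 \<le> n\<close> by (rule mult_right_mono) simp
    also have "\<dots> = m ^ (2 * (k + 1))"
      unfolding n power_mult by simp
    finally show ?thesis .
  qed
  ultimately have "(s + 2) ^ (3 * s) * (n ^ k + 1) < m ^ (2 * (k + 1)) * m ^ (2 * (k + 1))"
    by (intro mult_less_le_imp_less) auto
  also have "\<dots> = m ^ p"
  proof -
    have "p = 2 * (k + 1) + 2 * (k + 1)"
      by (simp add: p)
    then show ?thesis
      by (metis power_add)
  qed
  also have "\<dots> = card ((\<lambda>es. runs (pad es)) ` E)"
    using inj \<open>card E = m ^ p\<close> by (simp add: card_image)
  finally have "card (small_words k n s) < card ((\<lambda>es. runs (pad es)) ` E)"
    using small_words_bound(2) by (rule le_less_trans[rotated])
  then have "\<not> (\<lambda>es. runs (pad es)) ` E \<subseteq> small_words k n s"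
    using small_words_bound(1) card_mono by (metis not_le)
  then obtain es where es: "es \<in> E" "runs (pad es) \<notin> small_words k n s"
    by blast
  then have "length (pad es) = p + 1"
    by (simp add: pad_def E_def)
  from that[OF this pad(2)[OF es(1)] pad(1)[OF es(1), unfolded n_def] es(2)[unfolded n_def s_def]]
  show thesis .
qed

section \<open>Assembling the family and the asymptotic bound\<close>

theorem lemma2:
  "\<exists>F. string_family F \<and>
     (\<forall>k\<ge>1. (\<lambda>w. real (ell k w)) \<in>
        \<Omega>[growing F](\<lambda>w. real (g_rl w) * log 2 (real (length w)) / log 2 (log 2 (real (length w)))))"
proof -
  define p :: "nat \<Rightarrow> nat" where "p K = 4 * (K + 1)" for K
  define good where "good K es \<longleftrightarrow> length es = p K + 1 \<and> (\<forall>e\<in>set es. e > 1) \<and>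
    length (runs es) = 2 ^ 2 ^ (p K + 1) \<and>
    runs es \<notin> small_words K (2 ^ 2 ^ (p K + 1)) (2 ^ (p K - 4))" for K es
  have "\<exists>es. good K es" for K
    by (rule incompressible_runs[OF p_def[of K]]) (unfold good_def, blast)
  then obtain es where "\<And>K. good K (es K)"
    by metis
  then have es: "length (es K) = p K + 1" "\<forall>e\<in>set (es K). e > 1"
    "length (runs (es K)) = 2 ^ 2 ^ (p K + 1)"
    "runs (es K) \<notin> small_words K (2 ^ 2 ^ (p K + 1)) (2 ^ (p K - 4))" for K
    unfolding good_def by blast+
  define w where "w K = runs (es K)" for K
  have len: "length (w K) = 2 ^ 2 ^ (p K + 1)" for K
    by (simp add: w_def es(3))
  \<comment> \<open>Lengths grow strictly with \<open>K\<close>. This makes the family infinite and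
    turns the condition \<open>k <= K\<close> into the length threshold
    \<open>length (w k)\<close>.\<close>
  have len_le: "length (w K) \<le> length (w L) \<longleftrightarrow> K \<le> L" for K L
    by (simp add: len p_def)
  have ge: "K \<le> length (w K)" for K
  proof -
    have "K \<le> p K + 1" by (simp add: p_def)
    also have "\<dots> \<le> 2 ^ (p K + 1)" by (intro less_imp_le less_exp)
    also have "\<dots> \<le> 2 ^ 2 ^ (p K + 1)" by (intro less_imp_le less_exp)
    finally show ?thesis by (simp add: len)
  qed
  have "inj w"
    by (rule injI) (metis len_le order_antisym order_refl)
  then have "string_family (range w)"
    unfolding string_family_def using ge by (auto dest: finite_imageD)
  moreover have "(\<lambda>w. real (ell k w)) \<in>
      \<Omega>[growing (range w)](\<lambda>w. real (g_rl w) * log 2 (real (length w)) / log 2 (log 2 (real (length w))))"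
    if k: "k \<ge> 1" for k
  proof (rule landau_omega.bigI)
    \<comment> \<open>\<open>128 = 4 * 32\<close>: the grammar size is at most 4 per run, and
      \<open>log n\<close> is 32 times the lower bound on \<open>ell\<close>.\<close>
    show "(0::real) < 1 / 128" by simp
    have "1 / 128 * norm (real (g_rl (w K)) * log 2 (length (w K)) / log 2 (log 2 (length (w K))))
        \<le> norm (real (ell k (w K)))" if "k \<le> K" for K
    proof -
      have l1: "log 2 (length (w K)) = 2 ^ (p K + 1)"
      proof -
        have "log 2 (2 ^ 2 ^ (p K + 1)) = real (2 ^ (p K + 1))"
          by (rule log_pow_cancel) simp_all
        then show ?thesis
          unfolding len of_nat_power of_nat_numeral .
      qed
      have l2: "log 2 (2 ^ (p K + 1)) = real (p K + 1)"
        by (rule log_pow_cancel) simp_all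
      have "w K \<noteq> []"
        using len[of K] by (metis list.size(3) power_not_zero zero_neq_numeral)
      moreover have "w K \<notin> small_words K (length (w K)) (2 ^ (p K - 4))"
        using es(4) unfolding w_def es(3) .
      moreover have "set (w K) \<subseteq> {0, 1}"
        unfolding w_def by (rule set_runs)
      ultimately have "2 ^ (p K - 4) < ell k (w K)"
        using k that by (intro ell_gt[of _ K])
      then have "real (2 ^ (p K - 4)) \<le> real (ell k (w K))"
        by (intro of_nat_mono less_imp_le)
      then have "2 ^ (p K - 4) \<le> real (ell k (w K))"
        by simp
      moreover have "(2::real) ^ (p K + 1) = 32 * 2 ^ (p K - 4)"
        by (simp add: p_def power_add)
      \<comment> \<open>The number of runs is exactly \<open>log log n\<close>, so the denominator
        cancels it and only \<open>4 * log n\<close> remains.\<close>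
      moreover have "real (g_rl (w K)) * 2 ^ (p K + 1) / real (p K + 1) \<le> 4 * 2 ^ (p K + 1)"
      proof -
        have "g_rl (w K) \<le> 4 * (p K + 1)"
          using g_rl_runs[OF es(2), of K] es(1)[of K] by (simp add: w_def)
        then have "real (g_rl (w K)) \<le> 4 * real (p K + 1)"
          by linarith
        then have "real (g_rl (w K)) / real (p K + 1) \<le> 4"
          by (simp add: divide_le_eq)
        from mult_right_mono[OF this, of "2 ^ (p K + 1)"] show ?thesis
          by simp
      qed
      ultimately have "real (g_rl (w K)) * 2 ^ (p K + 1) / real (p K + 1) \<le> 128 * real (ell k (w K))"
        by linarith
      moreover have "0 \<le> real (g_rl (w K)) * 2 ^ (p K + 1) / real (p K + 1)"
        by simp
      moreover have "1 / 128 * norm x \<le> norm y" if "x \<le> 128 * y" "0 \<le> x" for x y :: real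
        using that by simp
      ultimately show ?thesis
        unfolding l1 l2 by blast
    qed
    then show "\<forall>\<^sub>F x in growing (range w). 1 / 128 *
        norm (real (g_rl x) * log 2 (length x) / log 2 (log 2 (length x))) \<le> norm (real (ell k x))"
      unfolding eventually_growing using len_le by (intro exI[of _ "length (w k)"]) blast
  qed
  ultimately show ?thesis by blast
qed

end
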